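(* Consider the generalized Sudoku problem with data $n, \pi_1, \pi_2, \pi_3, i_1, \ldots, i_k, g_{i_1}, \ldots, g_{i_k}$ and solution set $S(n,g)$, and let $x \in S(n, g)$. Then $x$ is the unique solution (i.e., $S(n,g) = \{x\}$) if and only if there does not exist a permutation $\tau$ of $\{1, \ldots, n^2\}$ such that $\tau(x) \ne x$, $\tau$ is $\pi_1$-consistent, $\pi_2$-$x$-consistent and $\pi_3$-$x$-consistent, and $\tau(i_l) = i_l$ for $l = 1, \ldots, k$.
   Context: For $y \in \mathbb{Z}^s$ write $y <> \mathbf{0}$ if every component of $y$ is nonzero. Let $n \ge 2$ and $s(n) = \sum_{i=1}^{n-1} i$. The $s(n) \times n$ matrix $A(n)$ is defined inductively: $A(1)$ is the empty matrix, and $A(m) = \begin{pmatrix} \mathbf{1}_{m-1} & -U_{m-1} \\ \mathbf{0}_{s(m-1)} & A(m-1) \end{pmatrix}$, where $\mathbf{1}_{m-1}$ is the all-ones column, $U_{m-1}$ the identity matrix and $\mathbf{0}_{s(m-1)}$ the zero column of length $s(m-1)$. Let $A$ be the $(n \cdot s(n)) \times n^2$ block-diagonal matrix whose $n$ diagonal blocks all equal $A(n)$. For a permutation $\pi$ of $\{1,\ldots,n^2\}$, $A_\pi$ is the matrix whose $j$-th column is the $\pi^{-1}(j)$-th column of $A$. For a permutation $\tau$ and $x \in \mathbb{Z}^{n^2}$, $\tau(x) = (x_{\tau^{-1}(1)}, \ldots, x_{\tau^{-1}(n^2)})^T$. The constraint sets of $\pi$ are $cs_\pi(j) = \{\pi(i)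 \mid (j-1)n + 1 \le i \le jn\}$, $j=1,\ldots,n$. A permutation $\tau$ is $\pi$-consistent if $\tau(cs_\pi(j)) = cs_\pi(j)$ for all $j$, and $\pi$-$x$-consistent if $\{x_{\tau^{-1}(i)} \mid i \in cs_\pi(j)\} = \{x_i \mid i \in cs_\pi(j)\}$ for all $j$. Generalized Sudoku problem: given permutations $\pi_1, \pi_2, \pi_3$ of $\{1, \ldots, n^2\}$, an integer $0 \le k \le n^2$, an index set $\{i_1, \ldots, i_k\} \subset \{1, \ldots, n^2\}$ and givens $g_{i_l} \in \mathbb{Z}$ with $1 \le g_{i_l} \le n$, its solution set is $S(n,g) = \{x \in \mathbb{Z}^{n^2} \mid 1 \le x_i \le n \ (i = 1,\ldots,n^2),\ A_{\pi_r}x <> \mathbf{0}\ (r = 1,2,3),\ x_{i_l} = g_{i_l}\ (l = 1, \ldots, k)\}$. *)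

theory Defs
  imports "Jordan_Normal_Form.Matrix" "HOL-Combinatorics.Permutations"
begin

text \<open>
  Matrices and vectors are those of \<^theory>\<open>Jordan_Normal_Form.Matrix\<close>, whose entries are
  numbered from 0. Permutations act on \<open>{1..n\<^sup>2}\<close>, so the component with the 1-based index
  \<open>i\<close> is the entry at position \<open>i - 1\<close>.
\<close>

definition component :: "'a vec \<Rightarrow> nat \<Rightarrow> 'a" where
  "component x i = x $ (i - 1)"

definition all_nonzero :: "int vec \<Rightarrow> bool" where
  "all_nonzero y \<longleftrightarrow> (\<forall>i < dim_vec y. y $ i \<noteq> 0)"

definition num_pairs :: "nat \<Rightarrow> nat" where
  "num_pairs n = (\<Sum>i = 1..n - 1. i)"

text \<open>
  The base case is the matrix with 0 rows and 1 column; the value at \<open>0\<close> is irrelevant.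
\<close>

fun diff_mat :: "nat \<Rightarrow> int mat" where
  "diff_mat 0 = 0\<^sub>m 0 0"
| "diff_mat (Suc 0) = 0\<^sub>m 0 1"
| "diff_mat (Suc (Suc m)) =
     four_block_mat
       (mat (Suc m) 1 (\<lambda>_. 1)) (- (1\<^sub>m (Suc m)))
       (0\<^sub>m (num_pairs (Suc m)) 1) (diff_mat (Suc m))"

definition sudoku_mat :: "nat \<Rightarrow> int mat" where
  "sudoku_mat n = diag_block_mat (replicate n (diff_mat n))"

definition permute_cols :: "(nat \<Rightarrow> nat) \<Rightarrow> 'a mat \<Rightarrow> 'a mat" where
  "permute_cols \<pi> M =
     mat (dim_row M) (dim_col M) (\<lambda>(i, j). component (row M i) (inv_into UNIV \<pi> (j + 1)))"

definition permute_vec :: "(nat \<Rightarrow> nat) \<Rightarrow> 'a vec \<Rightarrow> 'a vec" where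
  "permute_vec \<tau> x = vec (dim_vec x) (\<lambda>j. component x (inv_into UNIV \<tau> (j + 1)))"

definition constraint_set :: "nat \<Rightarrow> (nat \<Rightarrow> nat) \<Rightarrow> nat \<Rightarrow> nat set" where
  "constraint_set n \<pi> j = {\<pi> i | i. (j - 1) * n + 1 \<le> i \<and> i \<le> j * n}"

definition consistent :: "nat \<Rightarrow> (nat \<Rightarrow> nat) \<Rightarrow> (nat \<Rightarrow> nat) \<Rightarrow> bool" where
  "consistent n \<pi> \<tau> \<longleftrightarrow>
     (\<forall>j \<in> {1..n}. \<tau> ` constraint_set n \<pi> j = constraint_set n \<pi> j)"

definition vec_consistent ::
    "nat \<Rightarrow> (nat \<Rightarrow> nat) \<Rightarrow> int vec \<Rightarrow> (nat \<Rightarrow> nat) \<Rightarrow> bool" where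
  "vec_consistent n \<pi> x \<tau> \<longleftrightarrow>
     (\<forall>j \<in> {1..n}. {component x (inv_into UNIV \<tau> i) | i. i \<in> constraint_set n \<pi> j}
                  = {component x i | i. i \<in> constraint_set n \<pi> j})"

text \<open>
  The givens are \<open>g (ix 1), \<dots>, g (ix k)\<close> at the positions \<open>ix 1, \<dots>, ix k\<close>.
\<close>

definition sudoku_data ::
    "nat \<Rightarrow> (nat \<Rightarrow> nat) \<Rightarrow> (nat \<Rightarrow> nat) \<Rightarrow> (nat \<Rightarrow> nat)
      \<Rightarrow> nat \<Rightarrow> (nat \<Rightarrow> nat) \<Rightarrow> (nat \<Rightarrow> int) \<Rightarrow> bool" where
  "sudoku_data n \<pi>\<^sub>1 \<pi>\<^sub>2 \<pi>\<^sub>3 k ix g \<longleftrightarrow>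
     2 \<le> n \<and>
     \<pi>\<^sub>1 permutes {1..n\<^sup>2} \<and> \<pi>\<^sub>2 permutes {1..n\<^sup>2} \<and> \<pi>\<^sub>3 permutes {1..n\<^sup>2} \<and>
     k \<le> n\<^sup>2 \<and> inj_on ix {1..k} \<and> ix ` {1..k} \<subseteq> {1..n\<^sup>2} \<and>
     (\<forall>l \<in> {1..k}. 1 \<le> g (ix l) \<and> g (ix l) \<le> int n)"

definition sudoku_solutions ::
    "nat \<Rightarrow> (nat \<Rightarrow> nat) \<Rightarrow> (nat \<Rightarrow> nat) \<Rightarrow> (nat \<Rightarrow> nat)
      \<Rightarrow> nat \<Rightarrow> (nat \<Rightarrow> nat) \<Rightarrow> (nat \<Rightarrow> int) \<Rightarrow> int vec set" where
  "sudoku_solutions n \<pi>\<^sub>1 \<pi>\<^sub>2 \<pi>\<^sub>3 k ix g =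
     {x \<in> carrier_vec (n\<^sup>2).
        (\<forall>i \<in> {1..n\<^sup>2}. 1 \<le> component x i \<and> component x i \<le> int n) \<and>
        (\<forall>\<pi> \<in> {\<pi>\<^sub>1, \<pi>\<^sub>2, \<pi>\<^sub>3}. all_nonzero (permute_cols \<pi> (sudoku_mat n) *\<^sub>v x)) \<and>
        (\<forall>l \<in> {1..k}. component x (ix l) = g (ix l))}"

lemma diff_mat_carrier: "n \<ge> 1 \<Longrightarrow> diff_mat n \<in> carrier_mat (num_pairs n) n"
proof (induction n rule: diff_mat.induct)
  case (3 m)
  have "num_pairs (Suc (Suc m)) = Suc m + num_pairs (Suc m)"
    by (simp add: num_pairs_def)
  with 3 show ?case by auto
qed (auto simp: num_pairs_def)

lemma sudoku_mat_carrier: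
  assumes "n \<ge> 1"
  shows "sudoku_mat n \<in> carrier_mat (n * num_pairs n) (n\<^sup>2)"
proof -
  have "diag_block_mat (replicate k (diff_mat n)) \<in> carrier_mat (k * num_pairs n) (k * n)" for k
    using diff_mat_carrier[OF assms] by (induction k) (auto simp: Let_def)
  then show ?thesis by (simp add: sudoku_mat_def power2_eq_square)
qed

end

theory Submission
  imports Defs
begin

text \<open>
  A vector with entries in \<open>{1..n}\<close> satisfies \<open>A\<^sub>\<pi> x <> 0\<close> iff it maps every constraint set of
  \<open>\<pi>\<close> bijectively onto \<open>{1..n}\<close>. Hence the permutations \<open>\<tau>\<close> of the theorem turn solutions into
  solutions. Conversely, for a second solution \<open>y\<close> let \<open>\<tau>\<close> send \<open>i\<close> to the position, within the
  constraint set of \<open>\<pi>\<^sub>1\<close> containing \<open>i\<close>, at which \<open>y\<close> takes the value \<open>x\<^sub>i\<close>; then \<open>\<tau>(x) = y\<close>.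
\<close>

section \<open>Products without zero entries as injectivity on segments of the vector\<close>

lemma all_nonzero_append:
  "all_nonzero (v @\<^sub>v w) \<longleftrightarrow> all_nonzero v \<and> all_nonzero w"
proof
  assume *: "all_nonzero (v @\<^sub>v w)"
  have "v $ i \<noteq> 0" if "i < dim_vec v" for i
    using *[unfolded all_nonzero_def, rule_format, of i] that by simp
  moreover have "w $ i \<noteq> 0" if "i < dim_vec w" for i
    using *[unfolded all_nonzero_def, rule_format, of "dim_vec v + i"] that by simp
  ultimately show "all_nonzero v \<and> all_nonzero w" by (auto simp: all_nonzero_def)
qed (auto simp: all_nonzero_def)

text \<open>The rows of \<open>diff_mat m\<close> form the differences of all pairs of entries of
  \<open>v\<close>. The top block row compares the first entry with each later one and the lower
  block treats the pairs among the rest, so the induction peels off the first entry.\<close>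

lemma all_nonzero_diff_mat:
  assumes "m \<ge> 1" "v \<in> carrier_vec m"
  shows "all_nonzero (diff_mat m *\<^sub>v v) \<longleftrightarrow> inj_on (($) v) {..<m}"
  using assms
proof (induction m arbitrary: v rule: diff_mat.induct)
  case 1
  then show ?case by simp
next
  case 2
  then show ?case by (auto simp: all_nonzero_def inj_on_def)
next
  case (3 m v)
  define a where "a = vec 1 (\<lambda>_. v $ 0)"
  define d where "d = vec (Suc m) (\<lambda>i. v $ Suc i)"
  let ?D = "diff_mat (Suc m)"
  have D: "?D \<in> carrier_mat (num_pairs (Suc m)) (Suc m)"
    by (rule diff_mat_carrier) simp
  have v: "v = a @\<^sub>v d"
    using 3 by (intro eq_vecI) (auto simp: a_def d_def)
  have "diff_mat (Suc (Suc m)) *\<^sub>v v =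
      (mat (Suc m) 1 (\<lambda>_. 1) *\<^sub>v a + (- (1\<^sub>m (Suc m))) *\<^sub>v d)
        @\<^sub>v (0\<^sub>m (num_pairs (Suc m)) 1 *\<^sub>v a + ?D *\<^sub>v d)"
    unfolding v diff_mat.simps
    by (rule four_block_mat_mult_vec) (use D in \<open>auto simp: a_def d_def\<close>)
  also have "mat (Suc m) 1 (\<lambda>_. 1) *\<^sub>v a + (- (1\<^sub>m (Suc m))) *\<^sub>v d
      = vec (Suc m) (\<lambda>i. v $ 0 - v $ Suc i)"
    by (intro eq_vecI) (auto simp: a_def d_def scalar_prod_def)
  also have "0\<^sub>m (num_pairs (Suc m)) 1 *\<^sub>v a + ?D *\<^sub>v d = ?D *\<^sub>v d"
    using D by (intro eq_vecI) (auto simp: a_def)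
  finally have "all_nonzero (diff_mat (Suc (Suc m)) *\<^sub>v v) \<longleftrightarrow>
      (\<forall>i<Suc m. v $ 0 \<noteq> v $ Suc i) \<and> inj_on (($) d) {..<Suc m}"
    using 3(1)[of d] by (simp add: all_nonzero_append d_def) (simp add: all_nonzero_def)
  \<comment> \<open>Reading \<open>d\<close> as \<open>v\<close> shifted by one place merges both
    conditions into injectivity on a single index set: 0 together with the successors.\<close>
  also have "inj_on (($) d) {..<Suc m} \<longleftrightarrow> inj_on (($) v) (Suc ` {..<Suc m})"
    by (auto simp: inj_on_def d_def)
  also have "(\<forall>i<Suc m. v $ 0 \<noteq> v $ Suc i) \<and> inj_on (($) v) (Suc ` {..<Suc m}) \<longleftrightarrow>
      inj_on (($) v) (insert 0 (Suc ` {..<Suc m}))"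
    by auto
  also have "insert 0 (Suc ` {..<Suc m}) = {..<Suc (Suc m)}"
    by (simp only: lessThan_Suc_eq_insert_0)
  finally show ?case .
qed

lemma diag_block_mat_replicate_carrier:
  "A \<in> carrier_mat r c \<Longrightarrow> diag_block_mat (replicate k A) \<in> carrier_mat (k * r) (k * c)"
  by (induction k) (auto simp: Let_def)

text \<open>The off-diagonal blocks vanish, so each diagonal block sees only its own
  \<open>m\<close> consecutive entries. The induction removes the first block; block
  \<open>b\<close> of the remaining vector is block \<open>Suc b\<close> of
  \<open>v\<close>.\<close>

lemma all_nonzero_diag_diff_mat:
  assumes m: "m \<ge> 1" and "v \<in> carrier_vec (k * m)"
  shows "all_nonzero (diag_block_mat (replicate k (diff_mat m)) *\<^sub>v v) \<longleftrightarrow>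
    (\<forall>b<k. inj_on (\<lambda>i. v $ (b * m + i)) {..<m})"
  using assms(2)
proof (induction k arbitrary: v)
  case 0
  then show ?case by (simp add: all_nonzero_def)
next
  case (Suc k)
  let ?D = "diff_mat m" and ?B = "diag_block_mat (replicate k (diff_mat m))"
  have D: "?D \<in> carrier_mat (num_pairs m) m"
    by (rule diff_mat_carrier[OF m])
  then have B: "?B \<in> carrier_mat (k * num_pairs m) (k * m)"
    by (rule diag_block_mat_replicate_carrier)
  have block: "diag_block_mat (replicate (Suc k) ?D) =
      four_block_mat ?D (0\<^sub>m (num_pairs m) (k * m)) (0\<^sub>m (k * num_pairs m) m) ?B"
    by (simp only: replicate_Suc diag_block_mat.simps Let_def carrier_matD[OF D] carrier_matD[OF B])
  define a where "a = vec_first v m"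
  define d where "d = vec_last v (k * m)"
  have a: "a \<in> carrier_vec m" and d: "d \<in> carrier_vec (k * m)" and v: "v = a @\<^sub>v d"
    using vec_first_last_append[of v m "k * m"] Suc.prems by (simp_all add: a_def d_def)
  have "diag_block_mat (replicate (Suc k) ?D) *\<^sub>v v =
      (?D *\<^sub>v a + 0\<^sub>m (num_pairs m) (k * m) *\<^sub>v d)
        @\<^sub>v (0\<^sub>m (k * num_pairs m) m *\<^sub>v a + ?B *\<^sub>v d)"
    unfolding v block
    by (rule four_block_mat_mult_vec[OF D zero_carrier_mat zero_carrier_mat B a d])
  also have "?D *\<^sub>v a + 0\<^sub>m (num_pairs m) (k * m) *\<^sub>v d = ?D *\<^sub>v a"
    using D d by (intro eq_vecI) auto
  also have "0\<^sub>m (k * num_pairs m) m *\<^sub>v a + ?B *\<^sub>v d = ?B *\<^sub>v d"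
    using B a by (intro eq_vecI) auto
  finally have "all_nonzero (diag_block_mat (replicate (Suc k) ?D) *\<^sub>v v) \<longleftrightarrow>
      inj_on (($) a) {..<m} \<and> (\<forall>b<k. inj_on (\<lambda>i. d $ (b * m + i)) {..<m})"
    using all_nonzero_diff_mat[OF m a] Suc.IH[OF d] by (simp add: all_nonzero_append)
  also have "inj_on (($) a) {..<m} \<longleftrightarrow> inj_on (\<lambda>i. v $ (0 * m + i)) {..<m}"
    using a by (intro inj_on_cong) (simp add: v)
  also have "(\<forall>b<k. inj_on (\<lambda>i. d $ (b * m + i)) {..<m}) \<longleftrightarrow>
      (\<forall>b<k. inj_on (\<lambda>i. v $ (Suc b * m + i)) {..<m})"
  proof (intro all_cong inj_on_cong)
    fix b i assume "b < k" "i \<in> {..<m}"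
    \<comment> \<open>The bound keeps the index inside \<open>d\<close>; adding the length
      \<open>m\<close> of \<open>a\<close> gives the position in \<open>v\<close>.\<close>
    then have "b * m + i < Suc b * m" "Suc b * m \<le> k * m"
      by (simp, intro mult_le_mono1, simp)
    then have "b * m + i < k * m" by linarith
    then show "d $ (b * m + i) = v $ (Suc b * m + i)"
      using a d by (simp add: v add.assoc)
  qed
  also have "inj_on (\<lambda>i. v $ (0 * m + i)) {..<m}
        \<and> (\<forall>b<k. inj_on (\<lambda>i. v $ (Suc b * m + i)) {..<m}) \<longleftrightarrow>
      (\<forall>b<Suc k. inj_on (\<lambda>i. v $ (b * m + i)) {..<m})"
    by (simp only: All_less_Suc2)
  finally show ?case .
qed

section \<open>Moving the column permutation onto the vector\<close>

lemma permute_cols_mult_vec: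
  assumes M: "M \<in> carrier_mat r N" and x: "x \<in> carrier_vec N" and \<pi>: "\<pi> permutes {1..N}"
  shows "permute_cols \<pi> M *\<^sub>v x = M *\<^sub>v vec N (\<lambda>i. component x (\<pi> (i + 1)))"
proof (rule eq_vecI)
  fix i assume "i < dim_vec (M *\<^sub>v vec N (\<lambda>i. component x (\<pi> (i + 1))))"
  then have i: "i < r" using M by simp
  have "(permute_cols \<pi> M *\<^sub>v x) $ i =
      (\<Sum>j = 0..<N. component (row M i) (inv_into UNIV \<pi> (j + 1)) * component x (j + 1))"
    using M x i by (simp add: permute_cols_def scalar_prod_def component_def)
  \<comment> \<open>The permutation acts on 1-based positions, so the sum is first shifted to
    \<open>{1..N}\<close>. Reindexing along \<open>\<pi>\<close> then cancels the inverse in the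
    column number, and a shift back restores 0-based indices.\<close>
  also have "\<dots> = (\<Sum>j\<in>{1..N}. component (row M i) (inv_into UNIV \<pi> j) * component x j)"
    by (rule sum.reindex_bij_witness[of _ "\<lambda>j. j - 1" Suc]) auto
  also have "\<dots> = (\<Sum>j\<in>{1..N}. component (row M i) j * component x (\<pi> j))"
    by (subst sum.permute[OF \<pi>]) (simp add: permutes_inverses[OF \<pi>] o_def)
  also have "\<dots> = (\<Sum>j = 0..<N. component (row M i) (j + 1) * component x (\<pi> (j + 1)))"
    by (rule sum.reindex_bij_witness[of _ Suc "\<lambda>j. j - 1"]) auto
  also have "\<dots> = (M *\<^sub>v vec N (\<lambda>i. component x (\<pi> (i + 1)))) $ i"
    using M i by (simp add: scalar_prod_def component_def)
  finally show "(permute_cols \<pi> M *\<^sub>v x) $ i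
      = (M *\<^sub>v vec N (\<lambda>i. component x (\<pi> (i + 1)))) $ i" .
qed (use M in \<open>simp add: permute_cols_def\<close>)

section \<open>Constraint sets, and solutions as fillings that use every value in each of
  them\<close>

lemma constraint_set_eq_image:
  "constraint_set n \<pi> j = \<pi> ` {(j - 1) * n + 1..j * n}"
  by (auto simp: constraint_set_def)

text \<open>Matches the 1-based constraint sets with the 0-based segments of length \<open>n\<close>
  on which the diagonal blocks act.\<close>

lemma constraint_set_Suc:
  "constraint_set n \<pi> (Suc b) = (\<lambda>i. \<pi> (b * n + i + 1)) ` {..<n}"
proof -
  have "{b * n + 1..Suc b * n} = (\<lambda>i. b * n + i + 1) ` {..<n}"
  proof (intro equalityI subsetI)
    fix i assume "i \<in> {b * n + 1..Suc b * n}"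
    then show "i \<in> (\<lambda>i. b * n + i + 1) ` {..<n}"
      by (intro image_eqI[of _ _ "i - (b * n + 1)"]) auto
  qed auto
  then show ?thesis by (simp only: constraint_set_eq_image diff_Suc_1 image_image)
qed

text \<open>Once \<open>\<pi>\<close> has moved onto the vector, the diagonal block with 0-based
  number \<open>b\<close> sees exactly the components of \<open>x\<close> on the constraint set
  \<open>Suc b\<close>.\<close>

lemma all_nonzero_permute_cols_sudoku_mat:
  assumes n: "n \<ge> 1" and x: "x \<in> carrier_vec (n\<^sup>2)" and \<pi>: "\<pi> permutes {1..n\<^sup>2}"
  shows "all_nonzero (permute_cols \<pi> (sudoku_mat n) *\<^sub>v x) \<longleftrightarrow>
    (\<forall>j\<in>{1..n}. inj_on (component x) (constraint_set n \<pi> j))"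
proof -
  let ?w = "vec (n\<^sup>2) (\<lambda>i. component x (\<pi> (i + 1)))"
  have "all_nonzero (permute_cols \<pi> (sudoku_mat n) *\<^sub>v x) \<longleftrightarrow>
      (\<forall>b<n. inj_on (\<lambda>i. ?w $ (b * n + i)) {..<n})"
    unfolding permute_cols_mult_vec[OF sudoku_mat_carrier[OF n] x \<pi>]
    unfolding sudoku_mat_def
    by (rule all_nonzero_diag_diff_mat[OF n]) (simp add: power2_eq_square)
  also have "\<dots> \<longleftrightarrow> (\<forall>b<n. inj_on (component x) (constraint_set n \<pi> (Suc b)))"
  proof (intro all_cong)
    fix b assume b: "b < n"
    have "b * n + i < n\<^sup>2" if "i < n" for i
    proof -
      have "b * n + i < Suc b * n" using that by simp
      also have "\<dots> \<le> n * n" using b by (intro mult_le_mono1) simp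
      finally show ?thesis by (simp add: power2_eq_square)
    qed
    then have "inj_on (\<lambda>i. ?w $ (b * n + i)) {..<n} \<longleftrightarrow>
        inj_on (component x \<circ> (\<lambda>i. \<pi> (b * n + i + 1))) {..<n}"
      by (intro inj_on_cong) simp
    \<comment> \<open>As \<open>\<pi>\<close> is injective, so is the enumeration of the constraint
      set; hence injectivity of the composition and injectivity on the image agree.\<close>
    also have "\<dots> \<longleftrightarrow> inj_on (component x) (constraint_set n \<pi> (Suc b))"
      unfolding constraint_set_Suc
      by (rule comp_inj_on_iff[symmetric])
        (auto simp: inj_on_def dest: injD[OF permutes_inj[OF \<pi>]])
    finally show "inj_on (\<lambda>i. ?w $ (b * n + i)) {..<n} \<longleftrightarrow>
        inj_on (component x) (constraint_set n \<pi> (Suc b))" .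
  qed
  also have "\<dots> \<longleftrightarrow> (\<forall>j\<in>{1..n}. inj_on (component x) (constraint_set n \<pi> j))"
    by (auto simp: Suc_le_eq gr0_conv_Suc Ball_def)
  finally show ?thesis .
qed

text \<open>Blocks of \<open>n\<close> consecutive positions are the fibres of division by
  \<open>n\<close>, once positions are counted from 0. Pulling \<open>i\<close> back along
  \<open>\<pi>\<close> thus exhibits the constraint sets as the fibres of one function, so they
  partition \<open>{1..n\<^sup>2}\<close>.\<close>

lemma mem_constraint_set_iff:
  assumes n: "n \<ge> 1" and \<pi>: "\<pi> permutes {1..n\<^sup>2}" and j: "j \<in> {1..n}"
  shows "i \<in> constraint_set n \<pi> j \<longleftrightarrow> i \<in> {1..n\<^sup>2} \<and> (inv_into UNIV \<pi> i - 1) div n + 1 = j"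
proof -
  define k where "k = inv_into UNIV \<pi> i"
  have k: "k \<in> {1..n\<^sup>2} \<longleftrightarrow> i \<in> {1..n\<^sup>2}"
    unfolding k_def using permutes_in_image[OF permutes_inv[OF \<pi>]] .
  obtain b where b: "j = Suc b" "b < n" using j by (cases j) auto
  have le: "Suc b * n \<le> n\<^sup>2" using b unfolding power2_eq_square by (intro mult_le_mono1) simp
  have "i \<in> constraint_set n \<pi> j \<longleftrightarrow> k \<in> {b * n + 1..Suc b * n}"
    unfolding constraint_set_eq_image k_def b
    by (metis (no_types, lifting) image_iff permutes_inverses[OF \<pi>] diff_Suc_1)
  also have "\<dots> \<longleftrightarrow> k \<in> {1..n\<^sup>2} \<and> (k - 1) div n = b"
  proof
    assume "k \<in> {b * n + 1..Suc b * n}"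
    then show "k \<in> {1..n\<^sup>2} \<and> (k - 1) div n = b"
      using le n by (auto intro!: div_nat_eqI simp: mult.commute)
  next
    assume *: "k \<in> {1..n\<^sup>2} \<and> (k - 1) div n = b"
    then have "b * n \<le> k - 1" "k - 1 < Suc b * n"
      using n div_times_less_eq_dividend[of "k - 1" n] dividend_less_div_times[of n "k - 1"]
      by auto
    then show "k \<in> {b * n + 1..Suc b * n}" using * unfolding atLeastAtMost_iff by linarith
  qed
  finally show ?thesis unfolding k by (simp add: k_def b(1))
qed

lemma card_constraint_set:
  assumes \<pi>: "\<pi> permutes {1..n\<^sup>2}" and j: "j \<ge> 1"
  shows "card (constraint_set n \<pi> j) = n"
proof -
  have "card (constraint_set n \<pi> j) = card {(j - 1) * n + 1..j * n}"
    unfolding constraint_set_eq_image by (rule card_image[OF permutes_inj_on[OF \<pi>]])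
  then show ?thesis using j by (cases j) simp_all
qed

text \<open>A constraint set has \<open>n\<close> elements and there are \<open>n\<close> admissible
  values, so being injective on it and being onto \<open>{1..int n}\<close> coincide. The image form
  fits the consistency conditions, which equate sets of values.\<close>

lemma mem_sudoku_solutions_iff:
  assumes "sudoku_data n \<pi>\<^sub>1 \<pi>\<^sub>2 \<pi>\<^sub>3 k ix g"
  shows "x \<in> sudoku_solutions n \<pi>\<^sub>1 \<pi>\<^sub>2 \<pi>\<^sub>3 k ix g \<longleftrightarrow>
    x \<in> carrier_vec (n\<^sup>2) \<and> component x ` {1..n\<^sup>2} \<subseteq> {1..int n} \<and>
    (\<forall>\<pi>\<in>{\<pi>\<^sub>1, \<pi>\<^sub>2, \<pi>\<^sub>3}. \<forall>j\<in>{1..n}. component x ` constraint_set n \<pi> j = {1..int n}) \<and>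
    (\<forall>l\<in>{1..k}. component x (ix l) = g (ix l))"
proof -
  have n: "n \<ge> 1"
    and perm: "\<And>\<pi>. \<pi> \<in> {\<pi>\<^sub>1, \<pi>\<^sub>2, \<pi>\<^sub>3} \<Longrightarrow> \<pi> permutes {1..n\<^sup>2}"
    using assms by (auto simp: sudoku_data_def)
  have "inj_on (component x) (constraint_set n \<pi> j) \<longleftrightarrow>
      component x ` constraint_set n \<pi> j = {1..int n}"
    if range: "component x ` {1..n\<^sup>2} \<subseteq> {1..int n}"
      and \<pi>: "\<pi> \<in> {\<pi>\<^sub>1, \<pi>\<^sub>2, \<pi>\<^sub>3}" and j: "j \<in> {1..n}" for \<pi> j
  proof -
    have "constraint_set n \<pi> j \<subseteq> {1..n\<^sup>2}"
      using mem_constraint_set_iff[OF n perm[OF \<pi>] j] by blast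
    then have sub: "component x ` constraint_set n \<pi> j \<subseteq> {1..int n}"
      using range by blast
    have fin: "finite (constraint_set n \<pi> j)"
      by (simp add: constraint_set_eq_image)
    have card: "card (constraint_set n \<pi> j) = n"
      using card_constraint_set[OF perm[OF \<pi>]] j by simp
    show ?thesis
    proof
      assume "inj_on (component x) (constraint_set n \<pi> j)"
      then have "card (component x ` constraint_set n \<pi> j) = card {1..int n}"
        by (simp add: card_image card)
      then show "component x ` constraint_set n \<pi> j = {1..int n}"
        by (intro card_subset_eq sub) auto
    next
      assume "component x ` constraint_set n \<pi> j = {1..int n}"
      then show "inj_on (component x) (constraint_set n \<pi> j)"
        by (intro eq_card_imp_inj_on fin) (simp add: card)
    qed
  qed
  moreover have "(\<forall>i\<in>{1..n\<^sup>2}. 1 \<le> component x i \<and> component x i \<le> int n) \<longleftrightarrow>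
      component x ` {1..n\<^sup>2} \<subseteq> {1..int n}"
    by (auto simp: image_subset_iff)
  ultimately show ?thesis
    using all_nonzero_permute_cols_sudoku_mat[OF n _ perm]
    unfolding sudoku_solutions_def mem_Collect_eq by (smt (verit, best))
qed

section \<open>Permuted vectors, and a permutation carrying one filling to another\<close>

lemma permute_vec_carrier:
  "x \<in> carrier_vec N \<Longrightarrow> permute_vec \<tau> x \<in> carrier_vec N"
  by (auto simp only: permute_vec_def carrier_vec_def mem_Collect_eq dim_vec)

lemma component_permute_vec:
  assumes "x \<in> carrier_vec N" "i \<in> {1..N}"
  shows "component (permute_vec \<tau> x) i = component x (inv_into UNIV \<tau> i)"
proof -
  have "i - 1 < dim_vec x" "i - 1 + 1 = i" using assms by auto
  then show ?thesis
    unfolding component_def[of "permute_vec \<tau> x"] by (simp only: permute_vec_def index_vec)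
qed

lemma eq_vec_componentI:
  assumes "x \<in> carrier_vec N" "y \<in> carrier_vec N"
    and "\<And>i. i \<in> {1..N} \<Longrightarrow> component x i = component y i"
  shows "x = y"
proof (rule eq_vecI)
  fix i assume "i < dim_vec y"
  then show "x $ i = y $ i" using assms(2) assms(3)[of "Suc i"] by (simp add: component_def)
qed (use assms in auto)

text \<open>The function \<open>c\<close> labels classes. Each \<open>i\<close> goes to a place in
  its class where \<open>y\<close> has the value \<open>x i\<close>. Two points with the same image
  share class and \<open>x\<close>-value, hence are equal because \<open>x\<close> is injective on
  the class; an injective self-map of a finite set is bijective.\<close>

lemma ex_class_preserving_permutation:
  fixes x y :: "'a \<Rightarrow> 'b" and c :: "'a \<Rightarrow> 'c"
  assumes fin: "finite I"
    and x: "\<And>i. i \<in> I \<Longrightarrow> inj_on x {j \<in> I. c j = c i}"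
    and xy: "\<And>i. i \<in> I \<Longrightarrow> x ` {j \<in> I. c j = c i} = y ` {j \<in> I. c j = c i}"
  obtains \<tau> where "\<tau> permutes I" "\<And>i. i \<in> I \<Longrightarrow> c (\<tau> i) = c i" "\<And>i. i \<in> I \<Longrightarrow> y (\<tau> i) = x i"
proof -
  have "\<exists>j. j \<in> I \<and> c j = c i \<and> y j = x i" if "i \<in> I" for i
  proof -
    have "x i \<in> y ` {j \<in> I. c j = c i}" unfolding xy[OF that, symmetric] using that by blast
    then show ?thesis by auto
  qed
  then obtain f where f: "\<And>i. i \<in> I \<Longrightarrow> f i \<in> I \<and> c (f i) = c i \<and> y (f i) = x i"
    by metis
  have "inj_on f I"
  proof (rule inj_onI)
    fix i j assume ij: "i \<in> I" "j \<in> I" "f i = f j"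
    then have "c i = c j" "x i = x j" using f by metis+
    then show "i = j" using inj_onD[OF x[OF ij(2)]] ij by simp
  qed
  then have "bij_betw f I I"
    using endo_inj_surj[OF fin, of f] f by (auto simp: bij_betw_def)
  \<comment> \<open>The extension by the identity outside \<open>I\<close> is what
    \<open>permutes\<close> demands.\<close>
  then have "bij_betw (\<lambda>i. if i \<in> I then f i else i) I I"
    by (simp cong: bij_betw_cong)
  then have "(\<lambda>i. if i \<in> I then f i else i) permutes I"
    by (rule bij_imp_permutes) simp
  then show thesis by (rule that) (use f in auto)
qed

section \<open>Uniqueness of a solution in terms of permutations of it\<close>

theorem theorem4p3:
  fixes n k :: nat
    and \<pi>\<^sub>1 \<pi>\<^sub>2 \<pi>\<^sub>3 ix :: "nat \<Rightarrow> nat"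
    and g :: "nat \<Rightarrow> int"
    and x :: "int vec"
  assumes "sudoku_data n \<pi>\<^sub>1 \<pi>\<^sub>2 \<pi>\<^sub>3 k ix g"
    and "x \<in> sudoku_solutions n \<pi>\<^sub>1 \<pi>\<^sub>2 \<pi>\<^sub>3 k ix g"
  shows "sudoku_solutions n \<pi>\<^sub>1 \<pi>\<^sub>2 \<pi>\<^sub>3 k ix g = {x} \<longleftrightarrow>
    \<not> (\<exists>\<tau>. \<tau> permutes {1..n\<^sup>2} \<and>
           permute_vec \<tau> x \<noteq> x \<and>
           consistent n \<pi>\<^sub>1 \<tau> \<and>
           vec_consistent n \<pi>\<^sub>2 x \<tau> \<and>
           vec_consistent n \<pi>\<^sub>3 x \<tau> \<and>
           (\<forall>l \<in> {1..k}. \<tau> (ix l) = ix l))"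
proof -
  let ?S = "sudoku_solutions n \<pi>\<^sub>1 \<pi>\<^sub>2 \<pi>\<^sub>3 k ix g"
  let ?I = "{1..n\<^sup>2}" and ?cs = "constraint_set n"
  have n: "n \<ge> 1" and \<pi>1: "\<pi>\<^sub>1 permutes ?I" and perm: "\<And>\<pi>. \<pi> \<in> {\<pi>\<^sub>1, \<pi>\<^sub>2, \<pi>\<^sub>3} \<Longrightarrow> \<pi> permutes ?I"
    and ix: "\<And>l. l \<in> {1..k} \<Longrightarrow> ix l \<in> ?I"
    using assms(1) unfolding sudoku_data_def by (auto simp del: atLeastAtMost_iff)
  note S = mem_sudoku_solutions_iff[OF assms(1)]
  have x_vec: "x \<in> carrier_vec (n\<^sup>2)" and x_range: "component x ` ?I \<subseteq> {1..int n}"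
    and x_cs: "\<forall>\<pi>\<in>{\<pi>\<^sub>1, \<pi>\<^sub>2, \<pi>\<^sub>3}. \<forall>j\<in>{1..n}. component x ` ?cs \<pi> j = {1..int n}"
    and x_givens: "\<And>l. l \<in> {1..k} \<Longrightarrow> component x (ix l) = g (ix l)"
    using assms(2)[unfolded S] by blast+
  have cs_sub: "?cs \<pi> j \<subseteq> ?I" if "\<pi> \<in> {\<pi>\<^sub>1, \<pi>\<^sub>2, \<pi>\<^sub>3}" "j \<in> {1..n}" for \<pi> j
    using mem_constraint_set_iff[OF n perm[OF that(1)] that(2)] by blast
  \<comment> \<open>As \<open>x\<close> already takes all values on every constraint set,
    consistency of \<open>\<tau>\<close> with respect to \<open>\<pi>\<close> and \<open>x\<close>
    is precisely the constraint of \<open>\<pi>\<close> on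
    \<open>permute_vec \<tau> x\<close>.\<close>
  have vec_consistent_iff: "vec_consistent n \<pi> x \<tau> \<longleftrightarrow>
      (\<forall>j\<in>{1..n}. component (permute_vec \<tau> x) ` ?cs \<pi> j = {1..int n})"
    if \<pi>: "\<pi> \<in> {\<pi>\<^sub>1, \<pi>\<^sub>2, \<pi>\<^sub>3}" for \<pi> \<tau>
  proof -
    have "component (permute_vec \<tau> x) ` ?cs \<pi> j = {component x (inv_into UNIV \<tau> i) | i. i \<in> ?cs \<pi> j}"
      if "j \<in> {1..n}" for j
      unfolding Setcompr_eq_image
      using component_permute_vec[OF x_vec] cs_sub[OF \<pi> that] by (intro image_cong) auto
    moreover have "{component x i | i. i \<in> ?cs \<pi> j} = {1..int n}" if "j \<in> {1..n}" for j
      unfolding Setcompr_eq_image using x_cs \<pi> that by blast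
    ultimately show ?thesis unfolding vec_consistent_def by simp
  qed
  \<comment> \<open>A permutation with the listed consistency properties yields a solution, so one
    that changes \<open>x\<close> refutes uniqueness.\<close>
  have "permute_vec \<tau> x \<in> ?S"
    if \<tau>: "\<tau> permutes ?I" and 1: "consistent n \<pi>\<^sub>1 \<tau>" and 2: "vec_consistent n \<pi>\<^sub>2 x \<tau>"
      and 3: "vec_consistent n \<pi>\<^sub>3 x \<tau>" and givens: "\<forall>l\<in>{1..k}. \<tau> (ix l) = ix l" for \<tau>
  proof -
    have comp: "component (permute_vec \<tau> x) i = component x (inv_into UNIV \<tau> i)" if "i \<in> ?I" for i
      using x_vec that by (rule component_permute_vec)
    \<comment> \<open>The inverse of \<open>\<tau>\<close> also maps each constraint set of
      \<open>\<pi>\<^sub>1\<close> onto itself, so the set of values found there does not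
      change.\<close>
    have "vec_consistent n \<pi>\<^sub>1 x \<tau>"
      unfolding vec_consistent_def
    proof
      fix j assume "j \<in> {1..n}"
      then have "\<tau> ` ?cs \<pi>\<^sub>1 j = ?cs \<pi>\<^sub>1 j" using 1 by (simp add: consistent_def)
      then have "inv_into UNIV \<tau> ` ?cs \<pi>\<^sub>1 j = ?cs \<pi>\<^sub>1 j"
        by (metis image_inv_f_f permutes_inj[OF \<tau>])
      then show "{component x (inv_into UNIV \<tau> i) | i. i \<in> ?cs \<pi>\<^sub>1 j} = {component x i | i. i \<in> ?cs \<pi>\<^sub>1 j}"
        unfolding Setcompr_eq_image by (simp flip: image_image)
    qed
    then have "\<forall>\<pi>\<in>{\<pi>\<^sub>1, \<pi>\<^sub>2, \<pi>\<^sub>3}. \<forall>j\<in>{1..n}.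
        component (permute_vec \<tau> x) ` ?cs \<pi> j = {1..int n}"
      using 2 3 vec_consistent_iff by blast
    moreover have "permute_vec \<tau> x \<in> carrier_vec (n\<^sup>2)"
      using x_vec by (rule permute_vec_carrier)
    moreover have "component (permute_vec \<tau> x) ` ?I \<subseteq> {1..int n}"
    proof
      fix v assume "v \<in> component (permute_vec \<tau> x) ` ?I"
      then obtain i where "i \<in> ?I" "v = component x (inv_into UNIV \<tau> i)"
        using comp by blast
      then show "v \<in> {1..int n}"
        using x_range permutes_in_image[OF permutes_inv[OF \<tau>]] by blast
    qed
    moreover have "component (permute_vec \<tau> x) (ix l) = g (ix l)" if "l \<in> {1..k}" for l
    proof -
      have "inv_into UNIV \<tau> (ix l) = ix l" using givens that permutes_inverses(2)[OF \<tau>] by metis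
      then show ?thesis using x_givens[OF that] comp[OF ix[OF that]] by simp
    qed
    ultimately show ?thesis unfolding S by blast
  qed
  \<comment> \<open>Conversely, every other solution \<open>y\<close> arises from \<open>x\<close>
    by such a permutation.\<close>
  moreover have "\<exists>\<tau>. \<tau> permutes ?I \<and> permute_vec \<tau> x \<noteq> x \<and> consistent n \<pi>\<^sub>1 \<tau> \<and>
      vec_consistent n \<pi>\<^sub>2 x \<tau> \<and> vec_consistent n \<pi>\<^sub>3 x \<tau> \<and> (\<forall>l\<in>{1..k}. \<tau> (ix l) = ix l)"
    if "y \<in> ?S" "y \<noteq> x" for y
  proof -
    have y_vec: "y \<in> carrier_vec (n\<^sup>2)"
      and y_cs: "\<forall>\<pi>\<in>{\<pi>\<^sub>1, \<pi>\<^sub>2, \<pi>\<^sub>3}. \<forall>j\<in>{1..n}. component y ` ?cs \<pi> j = {1..int n}"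
      and y_givens: "\<And>l. l \<in> {1..k} \<Longrightarrow> component y (ix l) = g (ix l)"
      using \<open>y \<in> ?S\<close>[unfolded S] by blast+
    \<comment> \<open>The number of the constraint set of \<open>\<pi>\<^sub>1\<close> containing
      \<open>i\<close>; these sets are the classes to be preserved.\<close>
    define c where "c i = (inv_into UNIV \<pi>\<^sub>1 i - 1) div n + 1" for i
    have mem_cs: "i \<in> ?cs \<pi>\<^sub>1 j \<longleftrightarrow> i \<in> ?I \<and> c i = j" if "j \<in> {1..n}" for i j
      unfolding c_def by (rule mem_constraint_set_iff[OF n \<pi>1 that])
    have c: "c i \<in> {1..n}" if "i \<in> ?I" for i
    proof -
      have "inv_into UNIV \<pi>\<^sub>1 i \<in> ?I" using permutes_in_image[OF permutes_inv[OF \<pi>1]] that by blast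
      then have "inv_into UNIV \<pi>\<^sub>1 i - 1 < n * n" by (auto simp: power2_eq_square)
      then show ?thesis by (simp add: c_def less_mult_imp_div_less Suc_le_eq)
    qed
    have fibre: "{j \<in> ?I. c j = c i} = ?cs \<pi>\<^sub>1 (c i)" if "i \<in> ?I" for i
      using mem_cs[OF c[OF that]] by blast
    \<comment> \<open>A map from \<open>n\<close> elements onto \<open>n\<close> values is
      injective.\<close>
    have inj: "inj_on (component z) (?cs \<pi>\<^sub>1 j)"
      if "component z ` ?cs \<pi>\<^sub>1 j = {1..int n}" "j \<in> {1..n}"
      for z :: "int vec" and j
      using that card_constraint_set[OF \<pi>1, of j]
      by (intro eq_card_imp_inj_on) (auto simp: constraint_set_eq_image)
    \<comment> \<open>On each class \<open>x\<close> and \<open>y\<close> both have the value set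
      \<open>{1..int n}\<close>, and \<open>x\<close> takes each value only once.\<close>
    obtain \<tau> where \<tau>: "\<tau> permutes ?I" and c\<tau>: "\<And>i. i \<in> ?I \<Longrightarrow> c (\<tau> i) = c i"
      and y\<tau>: "\<And>i. i \<in> ?I \<Longrightarrow> component y (\<tau> i) = component x i"
    proof (rule ex_class_preserving_permutation[of ?I "component x" c "component y"])
      fix i assume i: "i \<in> ?I"
      show "inj_on (component x) {j \<in> ?I. c j = c i}"
        unfolding fibre[OF i] using inj x_cs c[OF i] by blast
      show "component x ` {j \<in> ?I. c j = c i} = component y ` {j \<in> ?I. c j = c i}"
        unfolding fibre[OF i] using x_cs y_cs c[OF i] by blast
    qed auto
    have in_I: "\<tau> i \<in> ?I \<longleftrightarrow> i \<in> ?I" for i by (rule permutes_in_image[OF \<tau>])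
    have "permute_vec \<tau> x = y"
    proof (rule eq_vec_componentI)
      fix i assume i: "i \<in> ?I"
      have "component (permute_vec \<tau> x) i = component x (inv_into UNIV \<tau> i)"
        using x_vec i by (rule component_permute_vec)
      also have "\<dots> = component y (\<tau> (inv_into UNIV \<tau> i))"
        using y\<tau>[of "inv_into UNIV \<tau> i"] permutes_in_image[OF permutes_inv[OF \<tau>]] i by metis
      finally show "component (permute_vec \<tau> x) i = component y i"
        by (simp add: permutes_inverses[OF \<tau>])
    qed (rule permute_vec_carrier[OF x_vec], rule y_vec)
    moreover have "consistent n \<pi>\<^sub>1 \<tau>"
      unfolding consistent_def
    proof
      fix j assume j: "j \<in> {1..n}"
      \<comment> \<open>Preserving labels gives only inclusion; finiteness and injectivity upgrade
        it to equality.\<close>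
      show "\<tau> ` ?cs \<pi>\<^sub>1 j = ?cs \<pi>\<^sub>1 j"
      proof (rule endo_inj_surj)
        show "finite (?cs \<pi>\<^sub>1 j)" by (simp add: constraint_set_eq_image)
        show "\<tau> ` ?cs \<pi>\<^sub>1 j \<subseteq> ?cs \<pi>\<^sub>1 j"
        proof (rule image_subsetI)
          fix i assume "i \<in> ?cs \<pi>\<^sub>1 j"
          then have i: "i \<in> ?I" "c i = j" unfolding mem_cs[OF j] by simp_all
          then show "\<tau> i \<in> ?cs \<pi>\<^sub>1 j"
            unfolding mem_cs[OF j] c\<tau>[OF i(1)] in_I by simp
        qed
        show "inj_on \<tau> (?cs \<pi>\<^sub>1 j)" by (rule permutes_inj_on[OF \<tau>])
      qed
    qed
    \<comment> \<open>Both places lie in the same class, and \<open>y\<close> agrees on them because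
      \<open>x\<close> and \<open>y\<close> share the given value at \<open>ix l\<close>;
      injectivity of \<open>y\<close> on the class identifies the places.\<close>
    moreover have "\<tau> (ix l) = ix l" if l: "l \<in> {1..k}" for l
    proof (rule inj_onD[OF inj[of y "c (ix l)"]])
      show "component y (\<tau> (ix l)) = component y (ix l)"
        using y\<tau>[OF ix[OF l]] x_givens[OF l] y_givens[OF l] by simp
      show "\<tau> (ix l) \<in> ?cs \<pi>\<^sub>1 (c (ix l))" "ix l \<in> ?cs \<pi>\<^sub>1 (c (ix l))"
        unfolding mem_cs[OF c[OF ix[OF l]]] c\<tau>[OF ix[OF l]] in_I using ix[OF l] by simp_all
    qed (use y_cs c[OF ix[OF l]] in blast)+
    \<comment> \<open>The permuted vector is \<open>y\<close>, whose own constraints for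
      \<open>\<pi>\<^sub>2\<close> and \<open>\<pi>\<^sub>3\<close> are these two
      conditions.\<close>
    moreover have "vec_consistent n \<pi>\<^sub>2 x \<tau>" "vec_consistent n \<pi>\<^sub>3 x \<tau>"
      using vec_consistent_iff \<open>permute_vec \<tau> x = y\<close> y_cs by blast+
    ultimately show ?thesis using \<tau> \<open>y \<noteq> x\<close> by blast
  qed
  ultimately show ?thesis using assms(2) by blast
qed

end
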